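(* Let $G$ be a trivializable planar graph and let $f:G\to\mathbb{R}^3$ be a spatial embedding of $G$. Then $$u(f)\le\frac{1}{2}c(f),$$ where $u(f)$ is the unknotting number of $f$ and $c(f)$ is the crossing number of $f$.
   Context: Graphs are finite. A graph $G$ is planar if it embeds in the plane $\mathbb{R}^2$ (equivalently in the 2-sphere $\mathbb{S}^2$). A spatial embedding of $G$ is a (tame) embedding $f:G\to\mathbb{R}^3$. Two spatial embeddings $f,g$ of $G$ are ambient isotopic if there is an ambient isotopy of $\mathbb{R}^3$, ending at a homeomorphism $h$ of $\mathbb{R}^3$, with $h\circ f=g$. Let $\pi:\mathbb{R}^3\to\mathbb{R}^2$, $\pi(x,y,z)=(x,y)$. A continuous map $\varphi:G\to\mathbb{R}^2$ is a generic immersion if it has only finitely many multiple points, each of which is a transversal double point of an edge or of two edges of $G$; these double points are called crossings. If $\pi\circ f$ is a generic immersion (always achievable up to ambient isotopy), then a regular diagram of $f$ is the image $\pi\circ f(G)$ together with vertex/edge labels and over/under information at each crossing. The crossing number $c(f)$ is the minimal number of crossings among all regular diagrams of spatial embeddings ambient isotopic to $f$. A crossing change replaces a spatial embedding by the one obtained by exchanging over and under at one crossing of some regular diagram of an embedding ambient isotopic to it. A spatial embedding $t$ of a planar graph $G$ is trivial (unknotted) if there is an embedded 2-sphere $S\subset\mathbb{R}^3$ with $t(G)\subset S$; any two trivial embeddings of a planar graph are ambient isotopic. The unknotting number $u(f)$ of a spatial embedding $f$ of a planar graph is the minimal number of crossing changes (ambient isotopies being allowed in between) needed to transform $f$ into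 a trivial embedding of $G$. A generic immersion $\varphi:G\to\mathbb{R}^2$ of a planar graph $G$ is a knotted projection if every spatial embedding $f$ of $G$ with $\pi\circ f=\varphi$ is not trivial. A planar graph is trivializable if it has no knotted projections. *)

theory Defs
  imports "HOL-Analysis.Analysis" "Graph_Theory.Digraph"
begin

section \<open>Finite graphs as topological spaces\<close>

text \<open>
  A graph is a \<^typ>\<open>('v,'e) pre_digraph\<close> satisfying \<^locale>\<open>fin_digraph\<close>: loops and multiple
  edges are allowed.  The direction of an arc only serves to parametrise the corresponding
  (undirected) edge by the unit interval.

  \<open>Inner e t\<close> is the point with parameter \<open>0 < t < 1\<close> on the edge \<open>e\<close>.
\<close>

datatype ('v, 'e) gpoint = Vertex 'v | Inner 'e real

definition edge_point :: "('v,'e) pre_digraph \<Rightarrow> 'e \<Rightarrow> real \<Rightarrow> ('v,'e) gpoint" where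
  "edge_point G e t =
     (if t = 0 then Vertex (tail G e) else if t = 1 then Vertex (head G e) else Inner e t)"

definition points :: "('v,'e) pre_digraph \<Rightarrow> ('v,'e) gpoint set" where
  "points G = Vertex ` verts G \<union> {Inner e t | e t. e \<in> arcs G \<and> 0 < t \<and> t < 1}"

text \<open>
  The quotient topology of the disjoint union of the vertices (discrete) and of one copy of
  \<open>[0,1]\<close> for every edge.
\<close>

definition realization :: "('v,'e) pre_digraph \<Rightarrow> ('v,'e) gpoint topology" where
  "realization G = topology (\<lambda>U. U \<subseteq> points G \<and>
     (\<forall>e\<in>arcs G. openin (top_of_set {0..1}) {t \<in> {0..1}. edge_point G e t \<in> U}))"

lemma openin_realization:
  "openin (realization G) U \<longleftrightarrow> U \<subseteq> points G \<and>
     (\<forall>e\<in>arcs G. openin (top_of_set {0..1}) {t \<in> {0..1}. edge_point G e t \<in> U})"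
proof -
  let ?P = "\<lambda>U. U \<subseteq> points G \<and>
     (\<forall>e\<in>arcs G. openin (top_of_set {0..1}) {t \<in> {0..1}. edge_point G e t \<in> U})"
  have "istopology ?P"
    unfolding istopology_def
  proof (intro conjI allI impI ballI)
    fix S T e assume ST: "?P S" "?P T"
    show "S \<inter> T \<subseteq> points G" using ST by blast
    assume e: "e \<in> arcs G"
    have "{t \<in> {0..1}. edge_point G e t \<in> S \<inter> T} =
          {t \<in> {0..1}. edge_point G e t \<in> S} \<inter> {t \<in> {0..1}. edge_point G e t \<in> T}"
      by blast
    then show "openin (top_of_set {0..1}) {t \<in> {0..1}. edge_point G e t \<in> S \<inter> T}"
      using ST e by (simp add: openin_Int)
  next
    fix \<K> assume K: "\<forall>K\<in>\<K>. ?P K"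
    show "\<Union>\<K> \<subseteq> points G" using K by blast
    fix e assume e: "e \<in> arcs G"
    have "{t \<in> {0..1}. edge_point G e t \<in> \<Union>\<K>} =
          \<Union>((\<lambda>K. {t \<in> {0..1}. edge_point G e t \<in> K}) ` \<K>)"
      by blast
    moreover have "openin (top_of_set {0..1})
        (\<Union>((\<lambda>K. {t \<in> {0..1}. edge_point G e t \<in> K}) ` \<K>))"
      using K e by (intro openin_Union) auto
    ultimately show "openin (top_of_set {0..1}) {t \<in> {0..1}. edge_point G e t \<in> \<Union>\<K>}"
      by simp
  qed
  then show ?thesis
    unfolding realization_def by (simp add: topology_inverse')
qed

lemma edge_point_in_points:
  assumes "wf_digraph G" "e \<in> arcs G" "t \<in> {0..1}"
  shows "edge_point G e t \<in> points G"
  using assms by (auto simp: edge_point_def points_def wf_digraph_def)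

lemma topspace_realization:
  assumes "wf_digraph G"
  shows "topspace (realization G) = points G"
proof
  show "topspace (realization G) \<subseteq> points G"
    by (metis openin_realization openin_topspace)
  have "{t \<in> {0..1}. edge_point G e t \<in> points G} = {0..1}" if "e \<in> arcs G" for e
    using edge_point_in_points[OF assms that] by blast
  then have "openin (realization G) (points G)"
    by (simp add: openin_realization)
  then show "points G \<subseteq> topspace (realization G)"
    by (rule openin_subset)
qed

definition planar_graph :: "('v,'e) pre_digraph \<Rightarrow> bool" where
  "planar_graph G \<longleftrightarrow>
     (\<exists>\<phi>. embedding_map (realization G) (euclidean :: (real^2) topology) \<phi>)"


section \<open>Spatial embeddings and ambient isotopy\<close>

text \<open>
  Maps from the graph are total functions on \<^typ>\<open>('v,'e) gpoint\<close>; only their values on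
  \<open>points G\<close> matter.  An isotopy is a homotopy through homeomorphisms.
\<close>

definition ambient_isotopic ::
  "('v,'e) pre_digraph \<Rightarrow> (('v,'e) gpoint \<Rightarrow> real^3) \<Rightarrow> (('v,'e) gpoint \<Rightarrow> real^3) \<Rightarrow> bool" where
  "ambient_isotopic G f g \<longleftrightarrow>
     (\<exists>h. homotopic_with (homeomorphic_map euclidean euclidean) euclidean euclidean id h \<and>
          (\<forall>p\<in>points G. h (f p) = g p))"

definition topological_embedding ::
  "('v,'e) pre_digraph \<Rightarrow> (('v,'e) gpoint \<Rightarrow> real^3) \<Rightarrow> bool" where
  "topological_embedding G f \<longleftrightarrow> embedding_map (realization G) euclidean f"

text \<open>
  For a continuous path, being piecewise linear means that the unit interval is covered by finitely
  many intervals on each of which the path is affine.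
\<close>

definition piecewise_linear :: "(real \<Rightarrow> real^3) \<Rightarrow> bool" where
  "piecewise_linear c \<longleftrightarrow>
     (\<exists>P. finite P \<and> {0..1} \<subseteq> \<Union>P \<and>
        (\<forall>I\<in>P. is_interval I \<and> (\<exists>a b. \<forall>t\<in>I \<inter> {0..1}. c t = a + t *\<^sub>R b)))"

text \<open>An embedding is tame if it is ambient isotopic to a polygonal one.\<close>

definition tame ::
  "('v,'e) pre_digraph \<Rightarrow> (('v,'e) gpoint \<Rightarrow> real^3) \<Rightarrow> bool" where
  "tame G f \<longleftrightarrow>
     (\<exists>g. topological_embedding G g \<and> (\<forall>e\<in>arcs G. piecewise_linear (g \<circ> edge_point G e)) \<and>
          ambient_isotopic G f g)"

definition spatial_embedding ::
  "('v,'e) pre_digraph \<Rightarrow> (('v,'e) gpoint \<Rightarrow> real^3) \<Rightarrow> bool" where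
  "spatial_embedding G f \<longleftrightarrow> topological_embedding G f \<and> tame G f"

definition trivial_embedding ::
  "('v,'e) pre_digraph \<Rightarrow> (('v,'e) gpoint \<Rightarrow> real^3) \<Rightarrow> bool" where
  "trivial_embedding G t \<longleftrightarrow> spatial_embedding G t \<and>
     (\<exists>S. S homeomorphic sphere (0 :: real^3) 1 \<and> t ` points G \<subseteq> S)"


section \<open>Generic immersions and regular diagrams\<close>

definition proj_xy :: "real^3 \<Rightarrow> real^2" where
  "proj_xy v = vector [v $ 1, v $ 2]"

definition multiple_points ::
  "('v,'e) pre_digraph \<Rightarrow> (('v,'e) gpoint \<Rightarrow> real^2) \<Rightarrow> (real^2) set" where
  "multiple_points G \<phi> = {x. \<exists>p\<in>points G. \<exists>q\<in>points G. p \<noteq> q \<and> \<phi> p = x \<and> \<phi> q = x}"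

text \<open>
  Since the maps are only continuous, transversality is topological: some chart of the plane around
  the double point takes the two local strands to the two coordinate axes.
\<close>

definition transversal_at ::
  "('v,'e) pre_digraph \<Rightarrow> (('v,'e) gpoint \<Rightarrow> real^2) \<Rightarrow> ('v,'e) gpoint \<Rightarrow> ('v,'e) gpoint \<Rightarrow> bool"
where
  "transversal_at G \<phi> p q \<longleftrightarrow>
     (\<exists>U \<psi> \<psi>' A B. open U \<and> \<phi> p \<in> U \<and>
        homeomorphism U (UNIV :: (real^2) set) \<psi> \<psi>' \<and> \<psi> (\<phi> p) = 0 \<and>
        openin (realization G) A \<and> p \<in> A \<and> \<phi> ` A \<subseteq> U \<and>
        openin (realization G) B \<and> q \<in> B \<and> \<phi> ` B \<subseteq> U \<and>
        homeomorphic_map (subtopology (realization G) A) (top_of_set {y. y $ 2 = 0}) (\<psi> \<circ> \<phi>) \<and>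
        homeomorphic_map (subtopology (realization G) B) (top_of_set {y. y $ 1 = 0}) (\<psi> \<circ> \<phi>))"

definition generic_immersion ::
  "('v,'e) pre_digraph \<Rightarrow> (('v,'e) gpoint \<Rightarrow> real^2) \<Rightarrow> bool" where
  "generic_immersion G \<phi> \<longleftrightarrow>
     continuous_map (realization G) euclidean \<phi> \<and>
     finite (multiple_points G \<phi>) \<and>
     (\<forall>x\<in>multiple_points G \<phi>. \<exists>e s e' s'.
        {p \<in> points G. \<phi> p = x} = {Inner e s, Inner e' s'} \<and>
        transversal_at G \<phi> (Inner e s) (Inner e' s'))"

text \<open>
  A diagram is a labelled projection (the labelled image is recorded by the projection map itself)
  together with the over/under information: the set of pairs \<open>(p, q)\<close> of distinct points of the
  graph with the same projection such that \<open>p\<close> lies on the over strand.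
\<close>

type_synonym ('v, 'e) diagram =
  "(('v,'e) gpoint \<Rightarrow> real^2) \<times> (('v,'e) gpoint \<times> ('v,'e) gpoint) set"

definition diagram_of ::
  "('v,'e) pre_digraph \<Rightarrow> (('v,'e) gpoint \<Rightarrow> real^3) \<Rightarrow> ('v,'e) diagram" where
  "diagram_of G f =
     (restrict (proj_xy \<circ> f) (points G),
      {(p, q). p \<in> points G \<and> q \<in> points G \<and> proj_xy (f p) = proj_xy (f q) \<and> f p $ 3 > f q $ 3})"

definition is_regular_diagram ::
  "('v,'e) pre_digraph \<Rightarrow> (('v,'e) gpoint \<Rightarrow> real^3) \<Rightarrow> ('v,'e) diagram \<Rightarrow> bool" where
  "is_regular_diagram G f D \<longleftrightarrow> generic_immersion G (proj_xy \<circ> f) \<and> D = diagram_of G f"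

definition crossings :: "('v,'e) pre_digraph \<Rightarrow> ('v,'e) diagram \<Rightarrow> (real^2) set" where
  "crossings G D = multiple_points G (fst D)"

definition switch_crossing :: "real^2 \<Rightarrow> ('v,'e) diagram \<Rightarrow> ('v,'e) diagram" where
  "switch_crossing x D =
     (fst D, {(p, q). if fst D p = x then (q, p) \<in> snd D else (p, q) \<in> snd D})"


section \<open>Crossing number and unknotting number\<close>

definition crossing_number ::
  "('v,'e) pre_digraph \<Rightarrow> (('v,'e) gpoint \<Rightarrow> real^3) \<Rightarrow> enat" where
  "crossing_number G f =
     Inf {enat (card (crossings G D)) | g D.
            spatial_embedding G g \<and> ambient_isotopic G f g \<and> is_regular_diagram G g D}"

text \<open>
  \<open>g'\<close> realises the diagram of \<open>g\<close> with one crossing switched.  A diagram determines such a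
  \<open>g'\<close> up to ambient isotopy.  Tameness of \<open>g'\<close> is automatic and not demanded separately: an
  embedding whose projection is a generic immersion is tame, since the planar Schoenflies theorem
  straightens the projection and a vertical isotopy then straightens the heights.
\<close>

definition crossing_change ::
  "('v,'e) pre_digraph \<Rightarrow> (('v,'e) gpoint \<Rightarrow> real^3) \<Rightarrow> (('v,'e) gpoint \<Rightarrow> real^3) \<Rightarrow> bool" where
  "crossing_change G f f' \<longleftrightarrow>
     (\<exists>g D x g'.
        ambient_isotopic G f g \<and> is_regular_diagram G g D \<and> x \<in> crossings G D \<and>
        topological_embedding G g' \<and> is_regular_diagram G g' (switch_crossing x D) \<and>
        ambient_isotopic G g' f')"

definition unknotting_number ::
  "('v,'e) pre_digraph \<Rightarrow> (('v,'e) gpoint \<Rightarrow> real^3) \<Rightarrow> enat" where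
  "unknotting_number G f =
     Inf {enat n | n. \<exists>t. (crossing_change G ^^ n) f t \<and> trivial_embedding G t}"


section \<open>Trivializable graphs\<close>

definition knotted_projection ::
  "('v,'e) pre_digraph \<Rightarrow> (('v,'e) gpoint \<Rightarrow> real^2) \<Rightarrow> bool" where
  "knotted_projection G \<phi> \<longleftrightarrow> generic_immersion G \<phi> \<and>
     (\<forall>f. spatial_embedding G f \<and> (\<forall>p\<in>points G. proj_xy (f p) = \<phi> p) \<longrightarrow>
          \<not> trivial_embedding G f)"

definition trivializable :: "('v,'e) pre_digraph \<Rightarrow> bool" where
  "trivializable G \<longleftrightarrow> planar_graph G \<and> \<not> (\<exists>\<phi>. knotted_projection G \<phi>)"

end

theory Submission
  imports Defs
begin

text \<open>
  By trivializability, the projection of a minimal diagram of \<open>f\<close> is also the projection of a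
  trivial embedding \<open>t\<close>.  The mirror image of \<open>t\<close> is trivial as well, and every crossing of the
  diagram has to be switched for exactly one of \<open>t\<close> and its mirror image, so that one of them is
  reached by switching at most half of the crossings.  If no crossing has to be switched, then \<open>f\<close>
  itself is trivial, because embeddings with the same diagram differ by a homeomorphism of space
  over the plane.
\<close>

section \<open>Coordinates of space over the plane\<close>

definition lift_xy :: "real^2 \<Rightarrow> real \<Rightarrow> real^3" where
  "lift_xy v z = v $ 1 *\<^sub>R axis 1 1 + v $ 2 *\<^sub>R axis 2 1 + z *\<^sub>R axis 3 1"

lemma proj_lift_xy [simp]: "proj_xy (lift_xy v z) = v"
  by (simp add: proj_xy_def lift_xy_def vec_eq_iff forall_2 axis_def)

lemma lift_xy_3 [simp]: "lift_xy v z $ 3 = z"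
  by (simp add: lift_xy_def axis_def)

lemma lift_proj_xy [simp]: "lift_xy (proj_xy v) (v $ 3) = v"
  by (simp add: proj_xy_def lift_xy_def vec_eq_iff forall_3 axis_def)

lemma eq_xyz_iff: "v = w \<longleftrightarrow> proj_xy v = proj_xy w \<and> v $ 3 = w $ 3"
  by (metis lift_proj_xy)

lemma continuous_on_lift_xy [continuous_intros]:
  assumes "continuous_on A f" "continuous_on A g"
  shows "continuous_on A (\<lambda>x. lift_xy (f x) (g x))"
  unfolding lift_xy_def by (intro continuous_intros assms)

lemma continuous_on_proj_xy [continuous_intros]:
  assumes "continuous_on A f"
  shows "continuous_on A (\<lambda>x. proj_xy (f x))"
proof -
  \<comment> \<open>As a combination of axis vectors, the projection is within reach of
    \<open>continuous_intros\<close>.\<close>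
  have eq: "proj_xy v = v $ 1 *\<^sub>R axis 1 1 + v $ 2 *\<^sub>R axis 2 1" for v
    by (simp add: proj_xy_def vec_eq_iff forall_2 axis_def)
  show ?thesis
    unfolding eq by (intro continuous_intros assms)
qed

section \<open>Continuous maps and their extension\<close>

lemma continuous_map_euclidean_compose:
  fixes F :: "'b::topological_space \<Rightarrow> 'c::topological_space"
  assumes "continuous_map X euclidean f" "continuous_on UNIV F"
  shows "continuous_map X euclidean (\<lambda>x. F (f x))"
  using continuous_map_compose[of X euclidean f euclidean F] assms
  by (simp add: o_def)

lemma continuous_map_euclidean_compose2:
  fixes F :: "'b::topological_space \<times> 'c::topological_space \<Rightarrow> 'd::topological_space"
  assumes "continuous_map X euclidean f" "continuous_map X euclidean g" "continuous_on UNIV F"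
  shows "continuous_map X euclidean (\<lambda>x. F (f x, g x))"
proof (rule continuous_map_euclidean_compose[OF _ assms(3)])
  show "continuous_map X euclidean (\<lambda>x. (f x, g x))"
    using assms(1,2) continuous_map_pairedI[of X euclidean f euclidean g]
    by (simp add: euclidean_product_topology)
qed

lemma continuous_extension_real:
  fixes f :: "'a::euclidean_space \<Rightarrow> real"
  assumes "continuous_on S f" "closed S"
  obtains g where "continuous_on UNIV g" "\<And>x. x \<in> S \<Longrightarrow> g x = f x"
  using Tietze_unbounded[of S f UNIV] assms by auto

text \<open>Every function on a finite set is continuous, so Tietze's theorem applies. This spreads
  data prescribed at the crossings over the whole plane.\<close>

lemma continuous_interpolation_real:
  fixes f :: "'a::euclidean_space \<Rightarrow> real"
  assumes "finite S"
  obtains g where "continuous_on UNIV g" "\<And>x. x \<in> S \<Longrightarrow> g x = f x"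
  using continuous_extension_real[OF continuous_on_finite[OF assms, of f] finite_imp_closed[OF assms]]
    that by blast

section \<open>Compactness of graphs and embeddings\<close>

lemma compact_space_realization:
  assumes "fin_digraph G"
  shows "compact_space (realization G)"
proof -
  interpret fin_digraph G by fact
  have cont: "continuous_map (top_of_set {0..1}) (realization G) (edge_point G e)"
    if "e \<in> arcs G" for e
    unfolding continuous_map_def topspace_realization[OF wf_digraph_axioms]
    using that edge_point_in_points[OF wf_digraph_axioms that]
    by (auto simp: openin_realization)
  have "compactin (realization G) (edge_point G e ` {0..1})" if "e \<in> arcs G" for e
    by (rule image_compactin[OF _ cont[OF that]]) (simp add: compactin_subtopology)
  \<comment> \<open>The vertices are covered separately because an isolated vertex lies on no
    edge.\<close>
  moreover have "compactin (realization G) (Vertex ` verts G)"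
    by (rule finite_imp_compactin)
      (auto simp: topspace_realization[OF wf_digraph_axioms] points_def)
  ultimately have "compactin (realization G)
      (Vertex ` verts G \<union> \<Union>((\<lambda>e. edge_point G e ` {0..1}) ` arcs G))"
    by (intro compactin_Un compactin_Union) auto
  moreover have "Vertex ` verts G \<union> \<Union>((\<lambda>e. edge_point G e ` {0..1}) ` arcs G) = points G"
  proof
    have vert: "Vertex ` verts G \<subseteq> points G"
      by (simp add: points_def)
    show "Vertex ` verts G \<union> \<Union>((\<lambda>e. edge_point G e ` {0..1}) ` arcs G) \<subseteq> points G"
      using edge_point_in_points[OF wf_digraph_axioms] vert by auto
    have "Inner e t \<in> edge_point G e ` {0..1}" if "0 < t" "t < 1" for e t
      using that by (intro image_eqI[of _ _ t]) (auto simp: edge_point_def)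
    then show "points G \<subseteq> Vertex ` verts G \<union> \<Union>((\<lambda>e. edge_point G e ` {0..1}) ` arcs G)"
      by (fastforce simp: points_def)
  qed
  ultimately show ?thesis
    by (simp add: compact_space_def topspace_realization[OF wf_digraph_axioms])
qed

text \<open>The graph is compact and space is Hausdorff, so a continuous injection is a closed map
  and hence an embedding.\<close>

lemma topological_embedding_iff:
  assumes "fin_digraph G"
  shows "topological_embedding G f \<longleftrightarrow>
    continuous_map (realization G) euclidean f \<and> inj_on f (points G)"
proof -
  interpret fin_digraph G by fact
  note top = topspace_realization[OF wf_digraph_axioms]
  show ?thesis
  proof
    assume "topological_embedding G f"
    then show "continuous_map (realization G) euclidean f \<and> inj_on f (points G)"
      using homeomorphic_imp_continuous_map homeomorphic_imp_injective_map
      unfolding topological_embedding_def embedding_map_def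
      by (metis top continuous_map_in_subtopology)
  next
    assume *: "continuous_map (realization G) euclidean f \<and> inj_on f (points G)"
    then have "closed_map (realization G) euclidean f"
      by (intro continuous_imp_closed_map compact_space_realization assms) auto
    with * show "topological_embedding G f"
      unfolding topological_embedding_def by (intro injective_closed_imp_embedding_map) (auto simp: top)
  qed
qed

lemma topological_embedding_cong:
  assumes "fin_digraph G" "topological_embedding G f" "\<And>p. p \<in> points G \<Longrightarrow> f' p = f p"
  shows "topological_embedding G f'"
proof -
  interpret fin_digraph G by fact
  note top = topspace_realization[OF wf_digraph_axioms]
  show ?thesis
    using assms(2,3) continuous_map_eq[of "realization G" euclidean f f']
      inj_on_cong[of "points G" f' f]
    by (auto simp: topological_embedding_iff[OF assms(1)] top)
qed

text \<open>Allows values off the graph to be redefined, so that projections can later be compared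
  as total functions.\<close>

lemma trivial_embedding_cong:
  assumes "fin_digraph G" "trivial_embedding G f" "\<And>p. p \<in> points G \<Longrightarrow> f' p = f p"
  shows "trivial_embedding G f'"
proof -
  have "topological_embedding G f'"
    using topological_embedding_cong[of G f f'] assms
    by (auto simp: trivial_embedding_def spatial_embedding_def)
  then show ?thesis
    using assms(2,3) image_cong[of "points G" "points G" f' f]
    by (auto simp: trivial_embedding_def spatial_embedding_def tame_def ambient_isotopic_def)
qed

lemma ambient_isotopic_refl: "ambient_isotopic G f f"
  unfolding ambient_isotopic_def by (intro exI[of _ id]) (auto simp: homeomorphic_map_id)

section \<open>Reflection in the horizontal plane\<close>

definition mirror_xy :: "real^3 \<Rightarrow> real^3" where
  "mirror_xy v = lift_xy (proj_xy v) (- v $ 3)"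

lemma mirror_xy_simps [simp]:
  "proj_xy (mirror_xy v) = proj_xy v" "mirror_xy v $ 3 = - v $ 3" "mirror_xy (mirror_xy v) = v"
  by (simp_all add: mirror_xy_def)

lemma linear_mirror_xy: "linear mirror_xy"
  by (rule linearI) (simp_all add: mirror_xy_def lift_xy_def proj_xy_def vec_eq_iff forall_3 axis_def)

lemma homeomorphism_mirror_xy: "homeomorphism UNIV UNIV mirror_xy mirror_xy"
  by (rule homeomorphismI) (auto simp: mirror_xy_def intro!: continuous_intros)

lemma homeomorphic_map_mirror_xy: "homeomorphic_map euclidean euclidean mirror_xy"
  unfolding homeomorphic_map_maps homeomorphic_maps_def
  using homeomorphism_mirror_xy by (auto simp: homeomorphism_def intro!: exI[of _ mirror_xy])

text \<open>The isotopy is conjugated by the reflection. As the reflection is an involution, the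
  conjugated isotopy again starts at the identity, although the reflection itself reverses
  orientation.\<close>

lemma ambient_isotopic_mirror:
  assumes "ambient_isotopic G f g"
  shows "ambient_isotopic G (mirror_xy \<circ> f) (mirror_xy \<circ> g)"
proof -
  let ?P = "homeomorphic_map euclidean euclidean :: (real^3 \<Rightarrow> real^3) \<Rightarrow> bool"
  have cont: "continuous_map euclidean euclidean mirror_xy"
    by (rule homeomorphic_imp_continuous_map[OF homeomorphic_map_mirror_xy])
  from assms obtain h where h: "homotopic_with ?P euclidean euclidean id h"
      and hf: "\<forall>p\<in>points G. h (f p) = g p"
    unfolding ambient_isotopic_def by blast
  have "homotopic_with ?P euclidean euclidean (mirror_xy \<circ> id) (mirror_xy \<circ> h)"
    by (rule homotopic_with_compose_continuous_map_left[OF h cont])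
      (rule homeomorphic_map_compose[OF _ homeomorphic_map_mirror_xy])
  then have "homotopic_with ?P euclidean euclidean
      (mirror_xy \<circ> id \<circ> mirror_xy) (mirror_xy \<circ> h \<circ> mirror_xy)"
    by (rule homotopic_with_compose_continuous_map_right[OF _ cont])
      (rule homeomorphic_map_compose[OF homeomorphic_map_mirror_xy])
  moreover have "mirror_xy \<circ> id \<circ> mirror_xy = id"
    by (simp add: fun_eq_iff)
  ultimately show ?thesis
    using hf unfolding ambient_isotopic_def
    by (intro exI[of _ "mirror_xy \<circ> h \<circ> mirror_xy"]) auto
qed

lemma piecewise_linear_mirror:
  assumes "piecewise_linear c"
  shows "piecewise_linear (mirror_xy \<circ> c)"
proof -
  obtain P where P: "finite P" "{0..1} \<subseteq> \<Union>P"
      "\<And>I. I \<in> P \<Longrightarrow> is_interval I \<and> (\<exists>a b. \<forall>t\<in>I \<inter> {0..1}. c t = a + t *\<^sub>R b)"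
    using assms unfolding piecewise_linear_def by auto
  have "\<exists>a b. \<forall>t\<in>I \<inter> {0..1}. (mirror_xy \<circ> c) t = a + t *\<^sub>R b" if "I \<in> P" for I
  proof -
    obtain a b where "\<forall>t\<in>I \<inter> {0..1}. c t = a + t *\<^sub>R b"
      using P(3)[OF \<open>I \<in> P\<close>] by blast
    then have "\<forall>t\<in>I \<inter> {0..1}. (mirror_xy \<circ> c) t = mirror_xy a + t *\<^sub>R mirror_xy b"
      by (simp add: linear_add[OF linear_mirror_xy] linear_scale[OF linear_mirror_xy])
    then show ?thesis by blast
  qed
  moreover have "is_interval I" if "I \<in> P" for I
    using P(3)[OF that] by simp
  ultimately show ?thesis
    unfolding piecewise_linear_def using P(1,2) by (intro exI[of _ P]) simp
qed

lemma topological_embedding_mirror: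
  assumes "fin_digraph G" "topological_embedding G f"
  shows "topological_embedding G (mirror_xy \<circ> f)"
proof -
  have "continuous_map (realization G) euclidean (mirror_xy \<circ> f)"
    using assms homeomorphic_imp_continuous_map[OF homeomorphic_map_mirror_xy]
    by (auto simp: topological_embedding_iff intro: continuous_map_compose)
  moreover have "inj mirror_xy"
    by (metis injI mirror_xy_simps(3))
  ultimately show ?thesis
    using assms by (auto simp: topological_embedding_iff intro: comp_inj_on inj_on_subset)
qed

text \<open>The reflected sphere carries the reflected graph; the polygonal witness of tameness is
  reflected together with its isotopy.\<close>

lemma trivial_embedding_mirror:
  assumes "fin_digraph G" "trivial_embedding G f"
  shows "trivial_embedding G (mirror_xy \<circ> f)"
proof -
  obtain S where S: "S homeomorphic sphere (0 :: real^3) 1" "f ` points G \<subseteq> S"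
    using assms(2) unfolding trivial_embedding_def by blast
  have "homeomorphism S (mirror_xy ` S) mirror_xy mirror_xy"
    using homeomorphism_of_subsets[OF homeomorphism_mirror_xy] by blast
  then have "mirror_xy ` S homeomorphic sphere (0 :: real^3) 1"
    using S(1) by (meson homeomorphic_def homeomorphic_sym homeomorphic_trans)
  moreover have "(mirror_xy \<circ> f) ` points G \<subseteq> mirror_xy ` S"
    using S(2) by auto
  moreover have "spatial_embedding G (mirror_xy \<circ> f)"
  proof -
    have emb: "topological_embedding G f" and "tame G f"
      using assms(2) by (auto simp: trivial_embedding_def spatial_embedding_def)
    then obtain g where g: "topological_embedding G g"
        "\<forall>e\<in>arcs G. piecewise_linear (g \<circ> edge_point G e)" "ambient_isotopic G f g"
      unfolding tame_def by blast
    have "tame G (mirror_xy \<circ> f)"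
      unfolding tame_def
      using g topological_embedding_mirror[OF assms(1) g(1)] ambient_isotopic_mirror[OF g(3)]
        piecewise_linear_mirror
      by (intro exI[of _ "mirror_xy \<circ> g"]) (auto simp: comp_assoc)
    then show ?thesis
      using topological_embedding_mirror[OF assms(1) emb] by (simp add: spatial_embedding_def)
  qed
  ultimately show ?thesis
    unfolding trivial_embedding_def by blast
qed

section \<open>Switching sets of crossings\<close>

definition switch_crossings :: "(real^2) set \<Rightarrow> ('v,'e) diagram \<Rightarrow> ('v,'e) diagram" where
  "switch_crossings T D =
     (fst D, {(p, q). if fst D p \<in> T then (q, p) \<in> snd D else (p, q) \<in> snd D})"

lemma switch_crossings_empty: "switch_crossings {} D = D"
  by (simp add: switch_crossings_def)

text \<open>A strict inequality of heights never relates a point to itself, so only distinct points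
  on a common vertical line have to be compared.\<close>

lemma diagram_of_eq_switch_crossingsI:
  assumes "\<And>p. p \<in> points G \<Longrightarrow> proj_xy (g' p) = proj_xy (g p)"
    and "\<And>p q. p \<in> points G \<Longrightarrow> q \<in> points G \<Longrightarrow> p \<noteq> q \<Longrightarrow> proj_xy (g p) = proj_xy (g q) \<Longrightarrow>
      g' p $ 3 > g' q $ 3 \<longleftrightarrow>
        (if proj_xy (g p) \<in> T then g q $ 3 > g p $ 3 else g p $ 3 > g q $ 3)"
  shows "diagram_of G g' = switch_crossings T (diagram_of G g)"
proof -
  have "(p, q) \<in> snd (diagram_of G g') \<longleftrightarrow> (p, q) \<in> snd (switch_crossings T (diagram_of G g))"
    for p q
    using assms[of p] assms(1)[of q] assms(2)[of p q]
    by (cases "p = q") (auto simp: diagram_of_def switch_crossings_def)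
  then have "snd (diagram_of G g') = snd (switch_crossings T (diagram_of G g))"
    by auto
  moreover have "fst (diagram_of G g') = fst (switch_crossings T (diagram_of G g))"
    using assms(1) by (auto simp: diagram_of_def switch_crossings_def restrict_def)
  ultimately show ?thesis
    by (rule prod_eqI[rotated])
qed

lemma switch_crossing_switch_crossings:
  assumes "x \<notin> T"
  shows "switch_crossing x (switch_crossings T (diagram_of G g)) =
    switch_crossings (insert x T) (diagram_of G g)"
proof -
  let ?D = "diagram_of G g"
  \<comment> \<open>Related points have the same projection, so after the pair is swapped the test
    for membership in \<open>T\<close> gives the same answer. As \<open>x\<close> is not in
    \<open>T\<close>, no crossing is switched twice.\<close>
  have "fst ?D q = fst ?D p" if "(p, q) \<in> snd ?D \<or> (q, p) \<in> snd ?D" for p q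
    using that by (force simp: diagram_of_def)
  then have "(if fst ?D p = x then if fst ?D q \<in> T then (p, q) \<in> snd ?D else (q, p) \<in> snd ?D
      else if fst ?D p \<in> T then (q, p) \<in> snd ?D else (p, q) \<in> snd ?D) \<longleftrightarrow>
      (if fst ?D p \<in> insert x T then (q, p) \<in> snd ?D else (p, q) \<in> snd ?D)" for p q
    using assms by (smt (verit) insert_iff)
  then show ?thesis
    by (simp only: switch_crossing_def switch_crossings_def fst_conv snd_conv mem_Collect_eq prod.case)
qed

text \<open>
  Multiplying the height by a function of the projection that takes the value \<open>-1\<close> at the crossings
  in \<open>T\<close> and \<open>1\<close> at the others only has to be injective over the crossings, so that the
  zeros of this function elsewhere do no harm.
\<close>

lemma switch_crossings_realizable:
  assumes "fin_digraph G" "topological_embedding G g" "finite (multiple_points G (proj_xy \<circ> g))"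
  obtains g' where "topological_embedding G g'" "proj_xy \<circ> g' = proj_xy \<circ> g"
    "diagram_of G g' = switch_crossings T (diagram_of G g)"
proof -
  let ?X = "multiple_points G (proj_xy \<circ> g)"
  have g: "continuous_map (realization G) euclidean g" "inj_on g (points G)"
    using assms by (auto simp: topological_embedding_iff)
  obtain \<sigma> :: "real^2 \<Rightarrow> real" where \<sigma>: "continuous_on UNIV \<sigma>"
      and sgn: "\<And>x. x \<in> ?X \<Longrightarrow> \<sigma> x = (if x \<in> T then -1 else 1)"
    using continuous_interpolation_real[OF assms(3), of "\<lambda>x. if x \<in> T then -1 else 1"] by blast
  define g' where "g' = (\<lambda>p. lift_xy (proj_xy (g p)) (\<sigma> (proj_xy (g p)) * g p $ 3))"
  have proj: "proj_xy (g' p) = proj_xy (g p)" for p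
    by (simp add: g'_def)
  have mult: "proj_xy (g p) \<in> ?X"
    if "p \<in> points G" "q \<in> points G" "p \<noteq> q" "proj_xy (g p) = proj_xy (g q)" for p q
    using that by (auto simp: multiple_points_def)
  have "continuous_on UNIV (\<lambda>v. lift_xy (proj_xy v) (\<sigma> (proj_xy v) * v $ 3))"
    by (intro continuous_intros continuous_on_compose2[OF \<sigma>]) auto
  then have "continuous_map (realization G) euclidean g'"
    unfolding g'_def by (rule continuous_map_euclidean_compose[OF g(1)])
  moreover have "inj_on g' (points G)"
  proof (rule inj_onI, rule ccontr)
    fix p q assume pq: "p \<in> points G" "q \<in> points G" "g' p = g' q" "p \<noteq> q"
    then have eq: "proj_xy (g p) = proj_xy (g q)"
      using proj by metis
    with pq have "\<sigma> (proj_xy (g p)) \<noteq> 0"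
      using sgn[OF mult[of p q]] by (auto split: if_splits)
    moreover have "g' p $ 3 = g' q $ 3" using pq(3) by simp
    ultimately have "g p $ 3 = g q $ 3"
      by (simp add: g'_def eq)
    with eq have "g p = g q" by (simp add: eq_xyz_iff)
    with pq g(2) show False by (auto dest: inj_onD)
  qed
  ultimately have "topological_embedding G g'"
    by (simp add: topological_embedding_iff[OF assms(1)])
  moreover have "diagram_of G g' = switch_crossings T (diagram_of G g)"
  proof (rule diagram_of_eq_switch_crossingsI)
    fix p q assume pq: "p \<in> points G" "q \<in> points G" "p \<noteq> q" "proj_xy (g p) = proj_xy (g q)"
    show "g' p $ 3 > g' q $ 3 \<longleftrightarrow>
        (if proj_xy (g p) \<in> T then g q $ 3 > g p $ 3 else g p $ 3 > g q $ 3)"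
      using sgn[OF mult[OF pq]] pq(4) by (auto simp: g'_def)
  qed (simp add: proj)
  ultimately show ?thesis
    using that proj by (auto simp: fun_eq_iff)
qed

lemma crossings_diagram_of: "crossings G (diagram_of G g) = multiple_points G (proj_xy \<circ> g)"
  by (fastforce simp: crossings_def diagram_of_def multiple_points_def)

lemma crossing_changeI:
  assumes "ambient_isotopic G f g" "generic_immersion G (proj_xy \<circ> g)"
    and "x \<in> multiple_points G (proj_xy \<circ> g)"
    and "topological_embedding G g'" "proj_xy \<circ> g' = proj_xy \<circ> g"
    and "diagram_of G g' = switch_crossing x (diagram_of G g)"
  shows "crossing_change G f g'"
  unfolding crossing_change_def is_regular_diagram_def
  using assms crossings_diagram_of ambient_isotopic_refl by metis

text \<open>Crossings are switched one at a time. The isotopy from \<open>f\<close> to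
  \<open>g\<close> is absorbed by the first crossing change, which is why \<open>T\<close> is
  nonempty here.\<close>

lemma relpowp_crossing_change:
  assumes "fin_digraph G" "ambient_isotopic G f g" "topological_embedding G g"
    "generic_immersion G (proj_xy \<circ> g)"
    and "finite T" "T \<noteq> {}" "T \<subseteq> multiple_points G (proj_xy \<circ> g)"
    and "topological_embedding G g'" "proj_xy \<circ> g' = proj_xy \<circ> g"
    "diagram_of G g' = switch_crossings T (diagram_of G g)"
  shows "(crossing_change G ^^ card T) f g'"
  using assms(5-)
proof (induction T arbitrary: g' rule: finite_ne_induct)
  case (singleton x)
  have "diagram_of G g' = switch_crossing x (diagram_of G g)"
    using singleton switch_crossing_switch_crossings[of x "{}" G g]
    by (simp add: switch_crossings_empty)
  then have "crossing_change G f g'"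
    using crossing_changeI[OF assms(2,4)] singleton by blast
  then show ?case by auto
next
  case (insert x T)
  \<comment> \<open>The intermediate embedding keeps the projection of \<open>g\<close>, so
    \<open>x\<close> is still one of its crossings.\<close>
  obtain k where k: "topological_embedding G k" "proj_xy \<circ> k = proj_xy \<circ> g"
      "diagram_of G k = switch_crossings T (diagram_of G g)"
    using switch_crossings_realizable[OF assms(1,3)] assms(4)
    unfolding generic_immersion_def by blast
  have "(crossing_change G ^^ card T) f k"
    using insert.prems(1) insert.IH[OF _ k] by blast
  moreover have "diagram_of G g' = switch_crossing x (diagram_of G k)"
    using insert k(3) switch_crossing_switch_crossings[of x T G g] by simp
  then have "crossing_change G k g'"
    using crossing_changeI[OF ambient_isotopic_refl, of G k x g'] insert.prems k(2) assms(4)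
    by (simp add: o_def)
  ultimately show ?case
    using insert by auto
qed

section \<open>Embeddings with the same diagram\<close>

text \<open>
  The homeomorphism is affine on every vertical line.  Its slope only has to be right at the
  finitely many crossings; once the slope is chosen, the translation part is determined on the
  whole projection of the graph.
\<close>

lemma same_diagram_homeomorphism:
  assumes G: "fin_digraph G" and emb: "topological_embedding G g" "topological_embedding G t"
    and gen: "generic_immersion G (proj_xy \<circ> g)"
    and proj: "proj_xy \<circ> t = proj_xy \<circ> g" and diag: "diagram_of G t = diagram_of G g"
  obtains h k where "homeomorphism UNIV UNIV h k" "\<And>p. p \<in> points G \<Longrightarrow> h (g p) = t p"
proof -
  interpret fin_digraph G by fact
  note top = topspace_realization[OF wf_digraph_axioms]
  let ?\<phi> = "proj_xy \<circ> g"
  let ?X = "multiple_points G ?\<phi>"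
  have g: "continuous_map (realization G) euclidean g" "inj_on g (points G)"
    and t: "continuous_map (realization G) euclidean t" "inj_on t (points G)"
    using emb by (auto simp: topological_embedding_iff[OF G])
  have fin: "finite ?X" and \<phi>: "continuous_map (realization G) euclidean ?\<phi>"
    using gen by (auto simp: generic_immersion_def)
  have proj': "proj_xy (t p) = proj_xy (g p)" for p
    using proj by (auto simp: fun_eq_iff)
  have less: "t p $ 3 > t q $ 3 \<longleftrightarrow> g p $ 3 > g q $ 3"
    if "p \<in> points G" "q \<in> points G" "?\<phi> p = ?\<phi> q" for p q
  proof -
    have "(p, q) \<in> snd (diagram_of G t) \<longleftrightarrow> (p, q) \<in> snd (diagram_of G g)"
      by (simp add: diag)
    then show ?thesis
      using that by (simp add: diagram_of_def proj')
  qed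
  \<comment> \<open>Exactly two points lie over a crossing, so one slope matches both height
    differences. It is positive because both embeddings have the same over strand.\<close>
  have "\<exists>a>0. \<forall>p\<in>points G. \<forall>q\<in>points G. ?\<phi> p = x \<and> ?\<phi> q = x \<longrightarrow>
      t p $ 3 - t q $ 3 = a * (g p $ 3 - g q $ 3)" if x: "x \<in> ?X" for x
  proof -
    from gen x obtain p q where pq: "{p \<in> points G. ?\<phi> p = x} = {p, q}"
      unfolding generic_immersion_def by blast
    then have pts: "p \<in> points G" "q \<in> points G" "?\<phi> p = x" "?\<phi> q = x" by blast+
    have "p \<noteq> q"
    proof
      assume "p = q"
      with pq have "r = p" if "r \<in> points G" "?\<phi> r = x" for r
        using that by blast
      with x show False
        unfolding multiple_points_def by blast
    qed
    then have "g p \<noteq> g q" using g(2) pts by (auto dest: inj_onD)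
    then have ne: "g p $ 3 \<noteq> g q $ 3" using pts by (simp add: eq_xyz_iff)
    define a where "a = (t p $ 3 - t q $ 3) / (g p $ 3 - g q $ 3)"
    have "a > 0"
      using less[OF pts(1,2)] less[OF pts(2,1)] pts(3,4) ne
      unfolding a_def by (auto simp: zero_less_divide_iff)
    moreover have eq: "t p $ 3 - t q $ 3 = a * (g p $ 3 - g q $ 3)"
      using ne by (simp add: a_def)
    moreover have "t q $ 3 - t p $ 3 = a * (g q $ 3 - g p $ 3)"
      using eq by (simp add: algebra_simps)
    ultimately have "t p' $ 3 - t q' $ 3 = a * (g p' $ 3 - g q' $ 3)"
      if "p' \<in> {p, q}" "q' \<in> {p, q}" for p' q'
      using that by auto
    with pq \<open>a > 0\<close> show ?thesis by (intro exI[of _ a]) blast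
  qed
  then obtain a where a: "\<And>x. x \<in> ?X \<Longrightarrow> a x > 0"
    "\<And>x p q. x \<in> ?X \<Longrightarrow> p \<in> points G \<Longrightarrow> q \<in> points G \<Longrightarrow> ?\<phi> p = x \<Longrightarrow> ?\<phi> q = x \<Longrightarrow>
      t p $ 3 - t q $ 3 = a x * (g p $ 3 - g q $ 3)"
    by metis
  \<comment> \<open>Interpolating the logarithms keeps the slope positive on the whole plane, not
    only at the crossings.\<close>
  obtain l where l: "continuous_on UNIV l" "\<And>x. x \<in> ?X \<Longrightarrow> l x = ln (a x)"
    using continuous_interpolation_real[OF fin, of "\<lambda>x. ln (a x)"] by blast
  define \<alpha> where "\<alpha> x = exp (l x)" for x
  have \<alpha>: "continuous_on UNIV \<alpha>" "\<And>x. \<alpha> x > 0" "\<And>x. x \<in> ?X \<Longrightarrow> \<alpha> x = a x"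
    using l a(1) by (auto simp: \<alpha>_def[abs_def] intro!: continuous_intros)
  \<comment> \<open>The translation that matches heights at \<open>p\<close>. By the choice of slope
    it is the same at both points over a crossing, so it descends to the projection.\<close>
  define b where "b p = t p $ 3 - \<alpha> (?\<phi> p) * g p $ 3" for p
  have b_eq: "b p = b q" if "p \<in> points G" "q \<in> points G" "?\<phi> p = ?\<phi> q" for p q
  proof (cases "p = q")
    case False
    with that have "?\<phi> p \<in> ?X" by (auto simp: multiple_points_def)
    from a(2)[OF this that(1,2) refl that(3)[symmetric]] \<alpha>(3)[OF this] show ?thesis
      unfolding b_def that(3)[symmetric] by (simp add: algebra_simps)
  qed simp
  define \<beta>0 where "\<beta>0 x = b (SOME p. p \<in> points G \<and> ?\<phi> p = x)" for x
  have \<beta>0: "\<beta>0 (?\<phi> p) = b p" if "p \<in> points G" for p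
  proof -
    have "\<exists>q. q \<in> points G \<and> ?\<phi> q = ?\<phi> p" using that by blast
    from someI_ex[OF this] show ?thesis
      unfolding \<beta>0_def using that by (intro b_eq) auto
  qed
  let ?K = "?\<phi> ` points G"
  have "compact_space (realization G)" by (rule compact_space_realization[OF G])
  then have compact: "compact ?K"
    using image_compactin[OF _ \<phi>, of "points G"] by (simp add: compact_space_def top)
  have "continuous_map (realization G) (top_of_set ?K) ?\<phi>"
    using \<phi> by (auto simp: continuous_map_in_subtopology top)
  \<comment> \<open>As a closed map from a compact space, the projection is a quotient map onto its
    image. Continuity of \<open>\<beta>0\<close> therefore follows from that of
    \<open>b\<close>.\<close>
  then have quot: "quotient_map (realization G) (top_of_set ?K) ?\<phi>"
    by (intro continuous_closed_imp_quotient_map continuous_imp_closed_map)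
      (auto simp: compact_space_realization[OF G] top Hausdorff_space_subtopology)
  have "continuous_on UNIV (\<lambda>(v, w). w $ 3 - \<alpha> (proj_xy v) * v $ 3)"
    unfolding case_prod_unfold
    by (intro continuous_intros continuous_on_compose2[OF \<alpha>(1)]) auto
  from continuous_map_euclidean_compose2[OF g(1) t(1) this]
  have "continuous_map (realization G) euclidean b"
    by (simp add: b_def[abs_def])
  then have "continuous_map (realization G) euclidean (\<beta>0 \<circ> ?\<phi>)"
    by (rule continuous_map_eq) (simp add: top \<beta>0[unfolded o_def])
  then have "continuous_map (top_of_set ?K) euclidean \<beta>0"
    by (rule continuous_compose_quotient_map[OF quot])
  then have "continuous_on ?K \<beta>0" by simp
  then obtain \<beta> where \<beta>: "continuous_on UNIV \<beta>" "\<And>x. x \<in> ?K \<Longrightarrow> \<beta> x = \<beta>0 x"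
    using continuous_extension_real[OF _ compact_imp_closed[OF compact]] by blast
  define h where "h v = lift_xy (proj_xy v) (\<alpha> (proj_xy v) * v $ 3 + \<beta> (proj_xy v))" for v
  define k where "k v = lift_xy (proj_xy v) ((v $ 3 - \<beta> (proj_xy v)) / \<alpha> (proj_xy v))" for v
  have \<alpha>_ne: "\<alpha> x \<noteq> 0" for x using \<alpha>(2)[of x] by simp
  have "homeomorphism UNIV UNIV h k"
  proof (rule homeomorphismI)
    show "continuous_on UNIV h" "continuous_on UNIV k"
      unfolding h_def k_def using \<alpha>_ne
      by (intro continuous_intros continuous_on_compose2[OF \<alpha>(1)] continuous_on_compose2[OF \<beta>(1)];
          simp)+
  qed (auto simp: h_def k_def \<alpha>_ne)
  moreover have "h (g p) = t p" if "p \<in> points G" for p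
  proof -
    have "\<beta> (proj_xy (g p)) = b p"
      using \<beta>(2)[of "?\<phi> p"] \<beta>0[OF that] that by simp
    then show ?thesis
      by (simp add: h_def b_def eq_xyz_iff proj')
  qed
  ultimately show ?thesis using that by blast
qed

text \<open>Triviality asks for a sphere containing the graph, so it suffices to pull the sphere
  back along the homeomorphism.\<close>

lemma trivial_embedding_homeomorphic:
  assumes "spatial_embedding G f" "trivial_embedding G t"
    "homeomorphism UNIV UNIV h k" "\<And>p. p \<in> points G \<Longrightarrow> h (f p) = t p"
  shows "trivial_embedding G f"
proof -
  obtain S where S: "S homeomorphic sphere (0 :: real^3) 1" "t ` points G \<subseteq> S"
    using assms(2) unfolding trivial_embedding_def by blast
  have "homeomorphism UNIV UNIV k h"
    using assms(3) by (rule homeomorphism_symD)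
  then have "homeomorphism S (k ` S) k h"
    by (rule homeomorphism_of_subsets) auto
  then have "k ` S homeomorphic sphere (0 :: real^3) 1"
    using S(1) by (meson homeomorphic_def homeomorphic_sym homeomorphic_trans)
  moreover have "f ` points G \<subseteq> k ` S"
  proof
    fix v assume "v \<in> f ` points G"
    then obtain p where p: "p \<in> points G" "v = f p" by blast
    then have "v = k (t p)"
      using assms(3,4) by (metis UNIV_I homeomorphism_apply1)
    then show "v \<in> k ` S" using p(1) S(2) by blast
  qed
  ultimately show ?thesis
    using assms(1) unfolding trivial_embedding_def by blast
qed

section \<open>Bounding the unknotting number\<close>

lemma unknotting_number_le_card:
  assumes G: "fin_digraph G" and f: "spatial_embedding G f" "ambient_isotopic G f g"
    and g: "topological_embedding G g" "generic_immersion G (proj_xy \<circ> g)"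
    and T: "T \<subseteq> multiple_points G (proj_xy \<circ> g)"
    and t: "trivial_embedding G t" "proj_xy \<circ> t = proj_xy \<circ> g"
      "diagram_of G t = switch_crossings T (diagram_of G g)"
  shows "unknotting_number G f \<le> enat (card T)"
proof -
  have fin: "finite T"
    using g(2) T finite_subset by (auto simp: generic_immersion_def)
  have emb: "topological_embedding G t"
    using t(1) by (simp add: trivial_embedding_def spatial_embedding_def)
  have "\<exists>t'. (crossing_change G ^^ card T) f t' \<and> trivial_embedding G t'"
  proof (cases "T = {}")
    \<comment> \<open>With zero crossing changes \<open>f\<close> itself has to be trivial. The end
      of the isotopy from \<open>f\<close> to \<open>g\<close>, followed by the homeomorphism from
      \<open>g\<close> to \<open>t\<close>, shows this.\<close>
    case True
    with t(3) have "diagram_of G t = diagram_of G g"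
      by (simp add: switch_crossings_empty)
    then obtain h k where hk: "homeomorphism UNIV UNIV h k"
        "\<And>p. p \<in> points G \<Longrightarrow> h (g p) = t p"
      using same_diagram_homeomorphism[OF G g(1) emb g(2) t(2)] by blast
    obtain h' where "homotopic_with (homeomorphic_map euclidean euclidean) euclidean euclidean id h'"
        and h': "\<forall>p\<in>points G. h' (f p) = g p"
      using f(2) unfolding ambient_isotopic_def by blast
    then have "homeomorphic_map euclidean euclidean h'"
      using homotopic_with_imp_property by blast
    then obtain k' where "homeomorphism UNIV UNIV h' k'"
      unfolding homeomorphic_map_maps homeomorphic_maps_def
      by (auto intro!: homeomorphismI)
    from homeomorphism_compose[OF this hk(1)] have "trivial_embedding G f"
      by (rule trivial_embedding_homeomorphic[OF f(1) t(1)]) (simp add: h' hk(2))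
    with True show ?thesis by auto
  next
    case False
    show ?thesis
      using relpowp_crossing_change[OF G f(2) g fin False T emb t(2,3)] t(1) by blast
  qed
  then show ?thesis
    unfolding unknotting_number_def by (intro Inf_lower) blast
qed

lemma half_ereal: "(1/2 :: ereal) = ereal (1/2)"
  by (simp add: one_ereal_def)

theorem proposition1p2:
  fixes G :: "('v,'e) pre_digraph" and f :: "('v,'e) gpoint \<Rightarrow> real^3"
  assumes "fin_digraph G" and "trivializable G" and "spatial_embedding G f"
  shows "ereal_of_enat (unknotting_number G f) \<le> 1/2 * ereal_of_enat (crossing_number G f)"
proof (cases "crossing_number G f = \<infinity>")
  case True
  then show ?thesis unfolding half_ereal by simp
next
  case False
  let ?C = "{enat (card (crossings G D)) | g D.
      spatial_embedding G g \<and> ambient_isotopic G f g \<and> is_regular_diagram G g D}"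
  have "?C \<noteq> {}"
    using False unfolding crossing_number_def by (metis Inf_empty top_enat_def)
  \<comment> \<open>A nonempty set of extended naturals attains its infimum, which gives a minimal
    diagram.\<close>
  then have "Inf ?C \<in> ?C"
    by (metis (no_types, lifting) LeastI_ex Inf_enat_def ex_in_conv)
  then have "crossing_number G f \<in> ?C"
    unfolding crossing_number_def .
  then obtain g where emb: "topological_embedding G g" and iso: "ambient_isotopic G f g"
      and gen: "generic_immersion G (proj_xy \<circ> g)"
      and c: "crossing_number G f = enat (card (crossings G (diagram_of G g)))"
    unfolding is_regular_diagram_def spatial_embedding_def by blast
  let ?\<phi> = "proj_xy \<circ> g"
  let ?X = "multiple_points G ?\<phi>"
  have fin: "finite ?X" using gen by (simp add: generic_immersion_def)
  obtain t0 where t0: "trivial_embedding G t0" "\<And>p. p \<in> points G \<Longrightarrow> proj_xy (t0 p) = ?\<phi> p"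
    using assms(2) gen unfolding trivializable_def knotted_projection_def by blast
  \<comment> \<open>Off the graph the values of \<open>g\<close> are used, so that the projections
    agree as functions.\<close>
  define t where "t p = (if p \<in> points G then t0 p else g p)" for p
  have t: "trivial_embedding G t"
    by (rule trivial_embedding_cong[OF assms(1) t0(1)]) (simp add: t_def)
  have proj: "proj_xy \<circ> t = ?\<phi>"
    using t0(2) by (auto simp: t_def)
  then have proj': "proj_xy (t p) = proj_xy (g p)" for p
    by (auto simp: fun_eq_iff)
  have inj: "inj_on g (points G)" "inj_on t (points G)"
    using emb t topological_embedding_iff[OF assms(1)]
    by (auto simp: trivial_embedding_def spatial_embedding_def)
  \<comment> \<open>The crossings at which \<open>g\<close> and \<open>t\<close> have different over
    strands.\<close>
  define S where "S = {?\<phi> p | p q. p \<in> points G \<and> q \<in> points G \<and> ?\<phi> p = ?\<phi> q \<and>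
    g p $ 3 > g q $ 3 \<and> t q $ 3 > t p $ 3}"
  have S: "S \<subseteq> ?X"
  proof
    fix x assume "x \<in> S"
    then obtain p q where "p \<in> points G" "q \<in> points G" "?\<phi> p = x" "?\<phi> q = x" "g p $ 3 > g q $ 3"
      unfolding S_def by auto
    then show "x \<in> ?X"
      unfolding multiple_points_def by (metis (mono_tags, lifting) less_irrefl mem_Collect_eq)
  qed
  have t_iff: "t p $ 3 > t q $ 3 \<longleftrightarrow> (if ?\<phi> p \<in> S then g q $ 3 > g p $ 3 else g p $ 3 > g q $ 3)"
    if pq: "p \<in> points G" "q \<in> points G" "p \<noteq> q" "?\<phi> p = ?\<phi> q" for p q
  proof -
    have "?\<phi> p \<in> ?X" using pq by (auto simp: multiple_points_def)
    with gen obtain p' q' where "{r \<in> points G. ?\<phi> r = ?\<phi> p} = {p', q'}"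
      unfolding generic_immersion_def by blast
    then have "r \<in> {p', q'}" if "r \<in> points G" "?\<phi> r = ?\<phi> p" for r
      using that by blast
    \<comment> \<open>The two distinct points \<open>p\<close> and \<open>q\<close> exhaust the
      fiber, so any pair witnessing membership in \<open>S\<close> is this pair in one of its two
      orders.\<close>
    from this[OF pq(1) refl] this[OF pq(2) pq(4)[symmetric]] this
    have fiber: "r = p \<or> r = q" if "r \<in> points G" "?\<phi> r = ?\<phi> p" for r
      using that pq(3) by blast
    have "g p \<noteq> g q" "t p \<noteq> t q" using inj pq by (auto dest: inj_onD)
    then have ne: "g p $ 3 \<noteq> g q $ 3" "t p $ 3 \<noteq> t q $ 3"
      using pq(4) by (auto simp: eq_xyz_iff proj')
    have "?\<phi> p \<in> S \<longleftrightarrow> g p $ 3 > g q $ 3 \<and> t q $ 3 > t p $ 3 \<or>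
        g q $ 3 > g p $ 3 \<and> t p $ 3 > t q $ 3"
    proof
      assume "?\<phi> p \<in> S"
      then obtain r s where rs: "r \<in> points G" "s \<in> points G" "?\<phi> r = ?\<phi> p" "?\<phi> s = ?\<phi> p"
          "g r $ 3 > g s $ 3" "t s $ 3 > t r $ 3"
        unfolding S_def by auto
      with fiber[OF rs(1,3)] fiber[OF rs(2,4)]
      show "g p $ 3 > g q $ 3 \<and> t q $ 3 > t p $ 3 \<or> g q $ 3 > g p $ 3 \<and> t p $ 3 > t q $ 3"
        by auto
    next
      assume "g p $ 3 > g q $ 3 \<and> t q $ 3 > t p $ 3 \<or> g q $ 3 > g p $ 3 \<and> t p $ 3 > t q $ 3"
      then show "?\<phi> p \<in> S"
      proof
        assume "g p $ 3 > g q $ 3 \<and> t q $ 3 > t p $ 3"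
        then show ?thesis unfolding S_def using pq by blast
      next
        assume "g q $ 3 > g p $ 3 \<and> t p $ 3 > t q $ 3"
        then have "?\<phi> q \<in> S" unfolding S_def using pq by (metis (mono_tags, lifting) mem_Collect_eq)
        then show ?thesis using pq(4) by simp
      qed
    qed
    with ne show ?thesis by auto
  qed
  have "diagram_of G t = switch_crossings S (diagram_of G g)"
    by (rule diagram_of_eq_switch_crossingsI) (use proj' t_iff in auto)
  then have 1: "unknotting_number G f \<le> enat (card S)"
    by (rule unknotting_number_le_card[OF assms(1,3) iso emb gen S t proj])
  \<comment> \<open>Reflection reverses every crossing of \<open>t\<close>, so it differs from
    \<open>g\<close> exactly at the crossings where \<open>t\<close> agrees with
    \<open>g\<close>.\<close>
  have "diagram_of G (mirror_xy \<circ> t) = switch_crossings (?X - S) (diagram_of G g)"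
  proof (rule diagram_of_eq_switch_crossingsI)
    fix p q assume pq: "p \<in> points G" "q \<in> points G" "p \<noteq> q" "proj_xy (g p) = proj_xy (g q)"
    then have "proj_xy (g q) \<in> ?X" by (auto simp: multiple_points_def)
    then show "(mirror_xy \<circ> t) p $ 3 > (mirror_xy \<circ> t) q $ 3 \<longleftrightarrow>
        (if proj_xy (g p) \<in> ?X - S then g q $ 3 > g p $ 3 else g p $ 3 > g q $ 3)"
      using t_iff[of q p] pq by auto
  qed (simp add: proj')
  moreover have "proj_xy \<circ> (mirror_xy \<circ> t) = ?\<phi>"
    using proj' by auto
  ultimately have 2: "unknotting_number G f \<le> enat (card (?X - S))"
    using unknotting_number_le_card[OF assms(1,3) iso emb gen _
        trivial_embedding_mirror[OF assms(1) t]] by blast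
  \<comment> \<open>The unknotting number is bounded by both summands, so twice its value is at most
    their sum.\<close>
  have "card S + card (?X - S) = card ?X"
    using S fin by (metis card_Diff_subset card_mono finite_subset le_add_diff_inverse)
  moreover obtain n where n: "unknotting_number G f = enat n"
    using 1 enat_ile by blast
  ultimately have "2 * n \<le> card ?X"
    using 1 2 by simp
  then have "ereal (real n) \<le> ereal (1/2 * real (card ?X))"
    by simp
  then show ?thesis
    unfolding n c crossings_diagram_of half_ereal by simp
qed

end
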